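(* Let $E, A \in \mathbb{C}^{n \times n}$, $B \in \mathbb{C}^{n \times m}$, $C \in \mathbb{C}^{p \times n}$, let $\Phi(s) = sE - A$, and let $G(s) = C (sE - A)^{-1} B$ be the associated transfer function, with derivative $G'(s) = \frac{d}{ds} G(s)$. Let the right quadrature nodes and weights $\{(\zeta_i, \varrho_i)\}_{i=1}^{N}$ and the left quadrature nodes and weights $\{(\vartheta_i, \varphi_i)\}_{i=1}^{N}$ (all real, with the same number $N$ of terms) be symmetric with respect to the origin, in the sense that there are $\omega_i, \xi_i \in \mathbb{R}$ with $$\zeta_i = \omega_i, \qquad \vartheta_i = -\omega_i, \qquad \varrho_i = \varphi_i = \xi_i, \qquad i = 1, \ldots, N.$$ Assume that $\Phi(\mathrm{i}\omega_i)$ and $\Phi(-\mathrm{i}\omega_i)$ are invertible for $i = 1, \ldots, N$. Define $\check{R} \in \mathbb{C}^{n \times mN}$ and $\check{L} \in \mathbb{C}^{n \times pN}$ by $$\check{R} = \begin{bmatrix} \varrho_1 \Phi(\mathrm{i}\zeta_1)^{-1} B & \cdots & \varrho_N \Phi(\mathrm{i}\zeta_N)^{-1} B \end{bmatrix}, \qquad \check{L}^{\mathsf H} = \begin{bmatrix} \varphi_1 C \Phi(\mathrm{i}\vartheta_1)^{-1} \\ \vdots \\ \varphi_N C \Phi(\mathrm{i}\vartheta_N)^{-1} \end{bmatrix},$$ and set $$\mathbb{E}_L = \check{L}^{\mathsf H} E \check{R}, \qquad \mathbb{A}_L = \check{L}^{\mathsf H} A \check{R}, \qquad \mathbb{B}_L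 = \check{L}^{\mathsf H} B, \qquad \mathbb{C}_L = C \check{R}.$$ Then for all $k, j = 1, \ldots, N$ the $p \times m$ blocks of these matrices are given by $$(\mathbb{E}_L)_{k,j} = \begin{cases} -\xi_k \xi_j\, G'(\mathrm{i}\omega_j) & \text{if } \omega_j = -\omega_k, \\[4pt] -\xi_k \xi_j\, \dfrac{G(-\mathrm{i}\omega_k) - G(\mathrm{i}\omega_j)}{-\mathrm{i}\omega_k - \mathrm{i}\omega_j} & \text{if } \omega_j \neq -\omega_k, \end{cases}$$ $$(\mathbb{A}_L)_{k,j} = \begin{cases} -\xi_k \xi_j \big( G(\mathrm{i}\omega_j) + \mathrm{i}\omega_j\, G'(\mathrm{i}\omega_j) \big) & \text{if } \omega_j = -\omega_k, \\[4pt] -\xi_k \xi_j\, \dfrac{-\mathrm{i}\omega_k G(-\mathrm{i}\omega_k) - \mathrm{i}\omega_j G(\mathrm{i}\omega_j)}{-\mathrm{i}\omega_k - \mathrm{i}\omega_j} & \text{if } \omega_j \neq -\omega_k, \end{cases}$$ $$(\mathbb{B}_L)_{k} = \xi_k\, G(-\mathrm{i}\omega_k), \qquad (\mathbb{C}_L)_{j} = \xi_j\, G(\mathrm{i}\omega_j).$$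
   Context: $\mathrm{i}$ is the imaginary unit and $M^{\mathsf H}$ is the conjugate transpose of $M$. Block notation: for a matrix $M \in \mathbb{C}^{pN \times mN}$, $(M)_{k,j}$ denotes the $p \times m$ submatrix formed by rows $(k-1)p+1, \ldots, kp$ and columns $(j-1)m+1, \ldots, jm$. For $\mathbb{B}_L \in \mathbb{C}^{pN \times m}$, $(\mathbb{B}_L)_k$ is the $p \times m$ block formed by rows $(k-1)p+1, \ldots, kp$. For $\mathbb{C}_L \in \mathbb{C}^{p \times mN}$, $(\mathbb{C}_L)_j$ is the $p \times m$ block formed by columns $(j-1)m+1, \ldots, jm$. *)

theory Defs
  imports
    "HOL-Analysis.Derivative"
    "Jordan_Normal_Form.Gauss_Jordan_Elimination"
    "Jordan_Normal_Form.Schur_Decomposition"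
begin

hide_const (open) Finite_Cartesian_Product.mat Finite_Cartesian_Product.vec

text \<open>
  Matrices have the type \<^typ>\<open>complex mat\<close> with explicit dimensions. Their entries are numbered
  from 0. Blocks, nodes and weights are numbered from 1.
\<close>

text \<open>Only meaningful for invertible square matrices; unspecified otherwise.\<close>
definition mat_inv :: "complex mat \<Rightarrow> complex mat" where
  "mat_inv M = the (mat_inverse M)"

definition pencil :: "complex mat \<Rightarrow> complex mat \<Rightarrow> complex \<Rightarrow> complex mat" where
  "pencil E A s = s \<cdot>\<^sub>m E - A"

definition transfer_fun ::
  "complex mat \<Rightarrow> complex mat \<Rightarrow> complex mat \<Rightarrow> complex mat \<Rightarrow> complex \<Rightarrow> complex mat" where
  "transfer_fun E A B C s = C * mat_inv (pencil E A s) * B"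

text \<open>
  The type of matrices of arbitrary dimension carries no topology, so the derivative of a
  matrix-valued function is taken entrywise, as the complex derivative of each entry.
\<close>
definition mat_deriv :: "(complex \<Rightarrow> complex mat) \<Rightarrow> complex \<Rightarrow> complex mat" where
  "mat_deriv F s =
     mat (dim_row (F s)) (dim_col (F s)) (\<lambda>(i, j). deriv (\<lambda>z. F z $$ (i, j)) s)"

text \<open>
  \<open>row_concat n m N X\<close> is \<open>[X 1 \<dots> X N]\<close> for \<open>n \<times> m\<close> blocks \<open>X i\<close>, and \<open>col_concat p n N Y\<close>
  is the vertical stack of the \<open>p \<times> n\<close> blocks \<open>Y 1, \<dots>, Y N\<close>.
\<close>
definition row_concat :: "nat \<Rightarrow> nat \<Rightarrow> nat \<Rightarrow> (nat \<Rightarrow> complex mat) \<Rightarrow> complex mat" where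
  "row_concat n m N X = mat n (m * N) (\<lambda>(r, c). X (c div m + 1) $$ (r, c mod m))"

definition col_concat :: "nat \<Rightarrow> nat \<Rightarrow> nat \<Rightarrow> (nat \<Rightarrow> complex mat) \<Rightarrow> complex mat" where
  "col_concat p n N Y = mat (p * N) n (\<lambda>(r, c). Y (r div p + 1) $$ (r mod p, c))"

definition mat_block :: "nat \<Rightarrow> nat \<Rightarrow> complex mat \<Rightarrow> nat \<Rightarrow> nat \<Rightarrow> complex mat" where
  "mat_block p m M k j = mat p m (\<lambda>(r, c). M $$ ((k - 1) * p + r, (j - 1) * m + c))"

definition row_block :: "nat \<Rightarrow> complex mat \<Rightarrow> nat \<Rightarrow> complex mat" where
  "row_block p M k = mat p (dim_col M) (\<lambda>(r, c). M $$ ((k - 1) * p + r, c))"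

definition col_block :: "nat \<Rightarrow> complex mat \<Rightarrow> nat \<Rightarrow> complex mat" where
  "col_block m M j = mat (dim_row M) m (\<lambda>(r, c). M $$ (r, (j - 1) * m + c))"

end

theory Submission
  imports Defs
begin

text \<open>
  Let \<open>P = \<Phi>(\<sigma>)\<^sup>-\<^sup>1\<close> and \<open>Q = \<Phi>(\<mu>)\<^sup>-\<^sup>1\<close>. Writing \<open>A\<close> once as \<open>\<sigma> E - \<Phi>(\<sigma>)\<close> and once as
  \<open>\<mu> E - \<Phi>(\<mu>)\<close> gives \<open>P A Q = \<sigma> P E Q - Q = \<mu> P E Q - P\<close>, hence the resolvent identity
  \<open>(\<sigma> - \<mu>) P E Q = Q - P\<close>. So \<open>C P E Q B\<close> is minus the divided difference of \<open>G\<close> between \<open>\<sigma>\<close> and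
  \<open>\<mu>\<close>; as inversion is continuous (Cramer's rule), letting \<open>\<sigma>\<close> tend to \<open>\<mu>\<close> identifies it with
  \<open>- G'(\<mu>)\<close> when \<open>\<sigma> = \<mu>\<close>. Eliminating \<open>P E Q\<close> instead yields \<open>C P A Q B\<close>. At \<open>\<sigma> = - \<i> \<omega>\<^sub>k\<close> and
  \<open>\<mu> = \<i> \<omega>\<^sub>j\<close> these products are, up to the weights, the \<open>(k, j)\<close> blocks.
\<close>

subsection \<open>Inverse matrices\<close>

lemma smult_smult_mat: "a \<cdot>\<^sub>m (b \<cdot>\<^sub>m M) = (a * b) \<cdot>\<^sub>m M" for a b :: "'a :: semigroup_mult"
  by (rule eq_matI) (auto simp: mult.assoc)

lemma one_smult_mat: "1 \<cdot>\<^sub>m M = M" for M :: "'a :: monoid_mult mat"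
  by (rule eq_matI) auto

text \<open>Multiplicativity of \<open>det\<close> gives one direction, the scaled adjugate the
  other. It turns invertibility into an open condition.\<close>

lemma invertible_mat_iff_det_nonzero:
  fixes M :: "'a :: field mat"
  assumes M: "M \<in> carrier_mat n n"
  shows "invertible_mat M \<longleftrightarrow> det M \<noteq> 0"
proof
  assume "invertible_mat M"
  then obtain X where MX: "M * X = 1\<^sub>m n" and XM: "X * M = 1\<^sub>m (dim_row X)"
    using M unfolding invertible_mat_def inverts_mat_def by auto
  \<comment> \<open>\<open>invertible_mat\<close> does not fix the shape of the inverse; both
    dimensions are read off from the two product equations.\<close>
  have "dim_col X = n" using arg_cong[OF MX, of dim_col] by simp
  moreover have "dim_row X = n" using arg_cong[OF XM, of dim_col] M by simp
  ultimately have X: "X \<in> carrier_mat n n" by auto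
  have "det M * det X = 1"
    using det_mult[OF M X] MX by simp
  then show "det M \<noteq> 0" by auto
next
  assume d: "det M \<noteq> 0"
  define X where "X = inverse (det M) \<cdot>\<^sub>m adj_mat M"
  have X: "X \<in> carrier_mat n n" using adj_mat(1)[OF M] by (simp add: X_def)
  have "M * X = 1\<^sub>m n"
    using adj_mat(2)[OF M] d mult_smult_distrib[OF M adj_mat(1)[OF M]]
    by (auto simp: X_def smult_smult_mat one_smult_mat)
  moreover have "X * M = 1\<^sub>m n"
    using adj_mat(3)[OF M] d mult_smult_assoc_mat[OF adj_mat(1)[OF M] M]
    by (auto simp: X_def smult_smult_mat one_smult_mat)
  ultimately show "invertible_mat M"
    using M X unfolding invertible_mat_def inverts_mat_def by auto
qed

lemma mat_inv:
  assumes M: "M \<in> carrier_mat n n" and inv: "invertible_mat M"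
  shows "mat_inv M \<in> carrier_mat n n"
    and "M * mat_inv M = 1\<^sub>m n"
    and "mat_inv M * M = 1\<^sub>m n"
proof -
  have "det M \<noteq> 0" using invertible_mat_iff_det_nonzero[OF M] inv by simp
  \<comment> \<open>Both facts speak of units of a matrix ring whose record has an arbitrary
    extension field; \<open>undefined\<close> fills it the same way in each.\<close>
  from det_non_zero_imp_unit[OF M this, of undefined] have "mat_inverse M \<noteq> None"
    using mat_inverse(1)[OF M, of undefined] by blast
  then obtain X where "mat_inverse M = Some X" by blast
  with mat_inverse(2)[OF M this]
  show "mat_inv M \<in> carrier_mat n n" "M * mat_inv M = 1\<^sub>m n" "mat_inv M * M = 1\<^sub>m n"
    by (auto simp: mat_inv_def)
qed

text \<open>Cramer's rule, obtained by multiplying \<open>M * adj_mat M\<close> by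
  \<open>mat_inv M\<close> from the left. It expresses the entries through determinants, whose
  continuity is accessible.\<close>

lemma mat_inv_eq_adj_mat:
  assumes M: "M \<in> carrier_mat n n" and inv: "invertible_mat M"
  shows "mat_inv M = inverse (det M) \<cdot>\<^sub>m adj_mat M"
proof -
  note X = mat_inv[OF M inv] and Y = adj_mat[OF M]
  have d: "det M \<noteq> 0" using invertible_mat_iff_det_nonzero[OF M] inv by simp
  have "adj_mat M = mat_inv M * M * adj_mat M"
    using X Y by simp
  also have "\<dots> = mat_inv M * (M * adj_mat M)"
    using assoc_mult_mat[OF X(1) M Y(1)] .
  also have "\<dots> = det M \<cdot>\<^sub>m mat_inv M"
    using X(1) by (simp add: Y(2) mult_smult_distrib[OF X(1) one_carrier_mat])
  finally show ?thesis using d by (simp add: smult_smult_mat one_smult_mat)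
qed

section \<open>Continuity of determinants, inverses and products\<close>

lemma isCont_det:
  fixes M :: "'a :: t2_space \<Rightarrow> 'b :: real_normed_field mat"
  assumes M: "\<And>z. M z \<in> carrier_mat n n"
    and cont: "\<And>i j. i < n \<Longrightarrow> j < n \<Longrightarrow> isCont (\<lambda>z. M z $$ (i, j)) s"
  shows "isCont (\<lambda>z. det (M z)) s"
proof -
  have "isCont (\<lambda>z. \<Sum>p | p permutes {0..<n}. signof p * (\<Prod>i = 0..<n. M z $$ (i, p i))) s"
    by (intro continuous_sum continuous_mult continuous_const continuous_prod cont)
      (auto simp: permutes_in_image)
  then show ?thesis by (simp add: det_def'[OF M])
qed

lemma
  fixes M :: "complex \<Rightarrow> complex mat"
  assumes M: "\<And>z. M z \<in> carrier_mat n n"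
    and cont: "\<And>i j. i < n \<Longrightarrow> j < n \<Longrightarrow> isCont (\<lambda>z. M z $$ (i, j)) s"
    and inv: "invertible_mat (M s)"
  shows eventually_invertible_mat: "\<forall>\<^sub>F z in nhds s. invertible_mat (M z)"
    and isCont_mat_inv: "i < n \<Longrightarrow> j < n \<Longrightarrow> isCont (\<lambda>z. mat_inv (M z) $$ (i, j)) s"
proof -
  have ds: "det (M s) \<noteq> 0" using inv invertible_mat_iff_det_nonzero[OF M] by simp
  have cd: "isCont (\<lambda>z. det (M z)) s" by (rule isCont_det[OF M cont])
  \<comment> \<open>\<open>isCont\<close> controls only the punctured neighbourhood; the point s
    itself is added by \<open>ds\<close>.\<close>
  have "\<forall>\<^sub>F z in nhds s. det (M z) \<noteq> 0"
    using cd t1_space_nhds[OF ds] ds unfolding isCont_def filterlim_iff eventually_nhds_conv_at[of _ s]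
    by blast
  then show ev: "\<forall>\<^sub>F z in nhds s. invertible_mat (M z)"
    by (simp add: invertible_mat_iff_det_nonzero[OF M])
  assume i: "i < n" and j: "j < n"
  \<comment> \<open>Row j and column i are deleted for entry (i, j), because the adjugate is the
    transposed cofactor matrix.\<close>
  have del: "isCont (\<lambda>z. det (mat_delete (M z) j i)) s"
  proof (rule isCont_det)
    show "mat_delete (M z) j i \<in> carrier_mat (n - 1) (n - 1)" for z
      using mat_delete_carrier[OF M] .
    fix i' j' assume "i' < n - 1" "j' < n - 1"
    then show "isCont (\<lambda>z. mat_delete (M z) j i $$ (i', j')) s"
      using i j carrier_matD[OF M] by (auto simp: mat_delete_def intro!: cont)
  qed
  have "isCont (\<lambda>z. inverse (det (M z)) * ((- 1) ^ (j + i) * det (mat_delete (M z) j i))) s"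
    using del cd ds by (intro continuous_intros) auto
  \<comment> \<open>Cramer's formula is available only where the matrix is invertible, hence near s;
    \<open>isCont_cong\<close> needs no more.\<close>
  moreover have eq: "\<forall>\<^sub>F z in nhds s. mat_inv (M z) $$ (i, j) =
      inverse (det (M z)) * ((- 1) ^ (j + i) * det (mat_delete (M z) j i))"
    using ev
  proof eventually_elim
    case (elim z)
    then show ?case
      using i j carrier_matD[OF M[of z]]
      by (simp add: mat_inv_eq_adj_mat[OF M] adj_mat_def cofactor_def)
  qed
  ultimately show "isCont (\<lambda>z. mat_inv (M z) $$ (i, j)) s"
    by (simp only: isCont_cong[OF eq])
qed

text \<open>The dimensions are required only near s, since \<open>mat_inv\<close> is unspecified,
  even in shape, at singular arguments.\<close>

lemma isCont_mult_mat:
  fixes F H :: "complex \<Rightarrow> complex mat"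
  assumes F: "\<forall>\<^sub>F z in nhds s. F z \<in> carrier_mat a b"
    and H: "\<forall>\<^sub>F z in nhds s. H z \<in> carrier_mat b c"
    and contF: "\<And>i k. i < a \<Longrightarrow> k < b \<Longrightarrow> isCont (\<lambda>z. F z $$ (i, k)) s"
    and contH: "\<And>k j. k < b \<Longrightarrow> j < c \<Longrightarrow> isCont (\<lambda>z. H z $$ (k, j)) s"
    and i: "i < a" and j: "j < c"
  shows "isCont (\<lambda>z. (F z * H z) $$ (i, j)) s"
proof -
  have "isCont (\<lambda>z. \<Sum>k = 0..<b. F z $$ (i, k) * H z $$ (k, j)) s"
    using i j by (intro continuous_sum continuous_mult contF contH) auto
  moreover have ev: "\<forall>\<^sub>F z in nhds s. (F z * H z) $$ (i, j) =
      (\<Sum>k = 0..<b. F z $$ (i, k) * H z $$ (k, j))"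
    using F H by eventually_elim (use i j in \<open>auto simp: scalar_prod_def\<close>)
  ultimately show ?thesis by (simp only: isCont_cong[OF ev])
qed

subsection \<open>Divided differences of the transfer function\<close>

lemma pencil_carrier:
  "E \<in> carrier_mat n n \<Longrightarrow> A \<in> carrier_mat n n \<Longrightarrow> pencil E A s \<in> carrier_mat n n"
  by (auto simp: pencil_def)

text \<open>This holds even at poles: the outer factors alone fix the dimensions of the
  product.\<close>

lemma transfer_fun_carrier:
  "B \<in> carrier_mat n m \<Longrightarrow> C \<in> carrier_mat p n \<Longrightarrow> transfer_fun E A B C s \<in> carrier_mat p m"
  unfolding transfer_fun_def by (metis carrier_matD carrier_matI index_mult_mat(2,3))

text \<open>The points \<sigma> and \<mu> may coincide, so divided differences and the derivative
  are treated together.\<close>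

locale two_point_pencil =
  fixes n m p :: nat and E A B C :: "complex mat" and \<sigma> \<mu> :: complex
  assumes E: "E \<in> carrier_mat n n" and A: "A \<in> carrier_mat n n"
    and B: "B \<in> carrier_mat n m" and C: "C \<in> carrier_mat p n"
    and inv\<sigma>: "invertible_mat (pencil E A \<sigma>)" and inv\<mu>: "invertible_mat (pencil E A \<mu>)"
begin

abbreviation "P \<equiv> mat_inv (pencil E A \<sigma>)"
abbreviation "Q \<equiv> mat_inv (pencil E A \<mu>)"

lemmas \<Phi> = pencil_carrier[OF E A]
lemmas P = mat_inv[OF \<Phi> inv\<sigma>]
lemmas Q = mat_inv[OF \<Phi> inv\<mu>]

lemma resolvent_A: "P * A * Q = \<sigma> \<cdot>\<^sub>m (P * E * Q) - Q"
proof -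
  have "A = \<sigma> \<cdot>\<^sub>m E - pencil E A \<sigma>"
    using E A by (auto simp: pencil_def)
  then have "P * A = P * (\<sigma> \<cdot>\<^sub>m E - pencil E A \<sigma>)" by simp
  also have "\<dots> = \<sigma> \<cdot>\<^sub>m (P * E) - 1\<^sub>m n"
    using E P by (simp add: mult_minus_distrib_mat[OF P(1) _ \<Phi>] mult_smult_distrib[OF P(1) E])
  finally have "P * A * Q = (\<sigma> \<cdot>\<^sub>m (P * E) - 1\<^sub>m n) * Q" by simp
  also have "\<dots> = \<sigma> \<cdot>\<^sub>m (P * E * Q) - Q"
    using minus_mult_distrib_mat[of "\<sigma> \<cdot>\<^sub>m (P * E)" n n "1\<^sub>m n" Q n]
      mult_smult_assoc_mat[of "P * E" n n Q n \<sigma>] E P(1) Q(1) by simp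
  finally show ?thesis .
qed

lemma resolvent_A': "P * A * Q = \<mu> \<cdot>\<^sub>m (P * E * Q) - P"
proof -
  have "A = \<mu> \<cdot>\<^sub>m E - pencil E A \<mu>"
    using E A by (auto simp: pencil_def)
  then have "A * Q = (\<mu> \<cdot>\<^sub>m E - pencil E A \<mu>) * Q" by simp
  also have "\<dots> = \<mu> \<cdot>\<^sub>m (E * Q) - 1\<^sub>m n"
    using E Q by (simp add: minus_mult_distrib_mat[OF _ \<Phi> Q(1)] mult_smult_assoc_mat[OF E Q(1)])
  finally have "P * (A * Q) = P * (\<mu> \<cdot>\<^sub>m (E * Q) - 1\<^sub>m n)" by simp
  also have "\<dots> = \<mu> \<cdot>\<^sub>m (P * (E * Q)) - P"
    using mult_minus_distrib_mat[of P n n "\<mu> \<cdot>\<^sub>m (E * Q)" n "1\<^sub>m n"]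
      mult_smult_distrib[of P n n "E * Q" n \<mu>] E P(1) Q(1) by simp
  finally show ?thesis
    using assoc_mult_mat[OF P(1) A Q(1)] assoc_mult_mat[OF P(1) E Q(1)] by simp
qed

text \<open>The bracketing follows the block product: \<open>C * P\<close> is an unweighted block of
  the left factor, \<open>Q * B\<close> one of the right factor. \<open>K_eq\<close> regroups it for
  the resolvent identities.\<close>

definition "K M = C * P * M * (Q * B)"

lemma K_eq:
  assumes "M \<in> carrier_mat n n"
  shows "K M = C * (P * M * Q) * B"
  unfolding K_def
  using assms P(1) Q(1) B C
  by (smt (verit) assoc_mult_mat mult_carrier_mat)

lemma K_carrier: "M \<in> carrier_mat n n \<Longrightarrow> K M \<in> carrier_mat p m"
  unfolding K_def using P(1) Q(1) B C by (meson mult_carrier_mat)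

lemma sandwich_diff:
  assumes X: "X \<in> carrier_mat n n" and Y: "Y \<in> carrier_mat n n"
  shows "C * (a \<cdot>\<^sub>m X - Y) * B = a \<cdot>\<^sub>m (C * X * B) - C * Y * B"
proof -
  have "C * (a \<cdot>\<^sub>m X - Y) * B = (a \<cdot>\<^sub>m (C * X) - C * Y) * B"
    using X Y C by (simp add: mult_minus_distrib_mat[OF C _ Y] mult_smult_distrib[OF C X])
  also have "\<dots> = a \<cdot>\<^sub>m (C * X * B) - C * Y * B"
    using X Y C B minus_mult_distrib_mat[of "a \<cdot>\<^sub>m (C * X)" p n "C * Y" B m]
      mult_smult_assoc_mat[of "C * X" p n B m a] by simp
  finally show ?thesis .
qed

lemma PEQ_carrier: "P * E * Q \<in> carrier_mat n n"
  using P(1) Q(1) E by simp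

text \<open>Together with \<open>K_A'\<close> this is a linear system for \<open>K A\<close> and
  \<open>K E\<close>, from which either unknown can be eliminated.\<close>

lemma K_A: "K A = \<sigma> \<cdot>\<^sub>m K E - transfer_fun E A B C \<mu>"
  using sandwich_diff[OF PEQ_carrier Q(1), of \<sigma>]
  by (simp add: K_eq[OF A] K_eq[OF E] resolvent_A transfer_fun_def)

lemma K_A': "K A = \<mu> \<cdot>\<^sub>m K E - transfer_fun E A B C \<sigma>"
  using sandwich_diff[OF PEQ_carrier P(1), of \<mu>]
  by (simp add: K_eq[OF A] K_eq[OF E] resolvent_A' transfer_fun_def)

text \<open>Equating the two expressions for \<open>K A\<close> eliminates it. Without division, the
  identity makes sense for coinciding points too.\<close>

lemma transfer_fun_diff:
  assumes "i < p" "j < m"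
  shows "transfer_fun E A B C \<sigma> $$ (i, j) - transfer_fun E A B C \<mu> $$ (i, j)
    = - (K E $$ (i, j)) * (\<sigma> - \<mu>)"
  using arg_cong[OF trans[OF K_A[symmetric] K_A'], of "\<lambda>X. X $$ (i, j)"] assms K_carrier[OF E]
    carrier_matD[OF transfer_fun_carrier[OF B C, of E A \<sigma>]]
    carrier_matD[OF transfer_fun_carrier[OF B C, of E A \<mu>]]
  by (simp add: algebra_simps)

text \<open>Up to sign this is a block of the Loewner matrix, and \<open>K_A_distinct\<close> gives
  one of the shifted Loewner matrix.\<close>

lemma K_E_distinct:
  assumes "\<sigma> \<noteq> \<mu>"
  shows "K E = - 1 \<cdot>\<^sub>m (inverse (\<sigma> - \<mu>) \<cdot>\<^sub>m
    (transfer_fun E A B C \<sigma> - transfer_fun E A B C \<mu>))"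
proof (rule eq_matI, goal_cases)
  case (1 i j)
  with transfer_fun_diff[of i j] assms carrier_matD[OF transfer_fun_carrier[OF B C, of E A]]
  show ?case by (simp add: field_simps)
qed (use carrier_matD[OF K_carrier[OF E]] carrier_matD[OF transfer_fun_carrier[OF B C, of E A]]
  in auto)

lemma K_A_distinct:
  assumes "\<sigma> \<noteq> \<mu>"
  shows "K A = - 1 \<cdot>\<^sub>m (inverse (\<sigma> - \<mu>) \<cdot>\<^sub>m
    (\<sigma> \<cdot>\<^sub>m transfer_fun E A B C \<sigma> - \<mu> \<cdot>\<^sub>m transfer_fun E A B C \<mu>))"
proof (rule eq_matI, goal_cases)
  case (1 i j)
  note dims = carrier_matD[OF transfer_fun_carrier[OF B C, of E A]] carrier_matD[OF K_carrier[OF E]]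
  have ij: "i < p" "j < m" using 1 dims by auto
  let ?g = "\<lambda>s. transfer_fun E A B C s $$ (i, j)"
  have 2: "K A $$ (i, j) = \<sigma> * K E $$ (i, j) - ?g \<mu>" "K A $$ (i, j) = \<mu> * K E $$ (i, j) - ?g \<sigma>"
    using ij dims arg_cong[OF K_A, of "\<lambda>X. X $$ (i, j)"] arg_cong[OF K_A', of "\<lambda>X. X $$ (i, j)"]
    by auto
  have "(\<sigma> - \<mu>) * K A $$ (i, j) = \<sigma> * K A $$ (i, j) - \<mu> * K A $$ (i, j)"
    by (simp add: algebra_simps)
  \<comment> \<open>The term with \<sigma> is rewritten by the second relation and the term with
    \<mu> by the first, so that the multiples of \<open>K E\<close> cancel. Premultiplying the
    relations directs each one to its own term.\<close>
  also have "\<dots> = - (\<sigma> * ?g \<sigma> - \<mu> * ?g \<mu>)"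
    unfolding 2(1)[THEN arg_cong[where f = "(*) \<mu>"]] 2(2)[THEN arg_cong[where f = "(*) \<sigma>"]]
    by (simp add: algebra_simps)
  finally have "K A $$ (i, j) = - (inverse (\<sigma> - \<mu>) * (\<sigma> * ?g \<sigma> - \<mu> * ?g \<mu>))"
    using assms by (simp add: field_simps)
  then show ?case using ij dims by simp
qed (use carrier_matD[OF K_carrier[OF A]] carrier_matD[OF transfer_fun_carrier[OF B C, of E A]]
  in auto)

end

section \<open>The derivative as the limit of merging points\<close>

lemma isCont_pencil:
  assumes "E \<in> carrier_mat n n" "A \<in> carrier_mat n n" "i < n" "j < n"
  shows "isCont (\<lambda>z. pencil E A z $$ (i, j)) s"
  using assms by (auto simp: pencil_def)

lemma mat_deriv_transfer_fun:
  assumes "two_point_pencil n m p E A B C s s"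
  shows "mat_deriv (transfer_fun E A B C) s = - 1 \<cdot>\<^sub>m two_point_pencil.K E A B C s s E"
proof -
  interpret s: two_point_pencil n m p E A B C s s by fact
  note E = s.E and A = s.A and B = s.B and C = s.C
  let ?\<Phi> = "pencil E A" and ?G = "transfer_fun E A B C"
  note \<Phi> = pencil_carrier[OF E A]
  have ev: "\<forall>\<^sub>F z in nhds s. invertible_mat (?\<Phi> z)"
    by (rule eventually_invertible_mat[OF \<Phi> isCont_pencil[OF E A] s.inv\<sigma>])
  have cont: "isCont (\<lambda>z. mat_inv (?\<Phi> z) $$ (i, j)) s" if "i < n" "j < n" for i j
    by (rule isCont_mat_inv[OF \<Phi> isCont_pencil[OF E A] s.inv\<sigma> that])
  \<comment> \<open>\<open>H z\<close> is \<open>K E\<close> with left point z and right point s.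
    Only one factor moves, so continuity at s reduces to that of \<open>mat_inv\<close>.\<close>
  define H where "H z = C * mat_inv (?\<Phi> z) * E * (mat_inv (?\<Phi> s) * B)" for z
  have Hs: "H s = s.K E" by (simp add: H_def s.K_def)
  have ev_inv: "\<forall>\<^sub>F z in nhds s. mat_inv (?\<Phi> z) \<in> carrier_mat n n"
    using ev by eventually_elim (rule mat_inv(1)[OF \<Phi>])
  have QB: "mat_inv (?\<Phi> s) * B \<in> carrier_mat n m" using s.Q(1) B by simp
  have c: "isCont (\<lambda>z. H z $$ (i, j)) s" if ij: "i < p" "j < m" for i j
  proof -
    have ev1: "\<forall>\<^sub>F z in nhds s. C * mat_inv (?\<Phi> z) \<in> carrier_mat p n"
      using ev_inv by eventually_elim (use C in simp)
    have ev2: "\<forall>\<^sub>F z in nhds s. C * mat_inv (?\<Phi> z) * E \<in> carrier_mat p n"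
      using ev1 by eventually_elim (use E in simp)
    have 1: "isCont (\<lambda>z. (C * mat_inv (?\<Phi> z)) $$ (i, j)) s" if "i < p" "j < n" for i j
      by (rule isCont_mult_mat[OF _ ev_inv _ cont that]) (use C in auto)
    have 2: "isCont (\<lambda>z. (C * mat_inv (?\<Phi> z) * E) $$ (i, j)) s" if "i < p" "j < n" for i j
      by (rule isCont_mult_mat[OF ev1 _ 1 _ that]) (use E in auto)
    show ?thesis unfolding H_def
      by (rule isCont_mult_mat[OF ev2 _ 2 _ ij]) (use QB in auto)
  qed
  have "deriv (\<lambda>z. ?G z $$ (i, j)) s = - (s.K E $$ (i, j))" if ij: "i < p" "j < m" for i j
  proof (rule DERIV_imp_deriv)
    have "((\<lambda>z. - (H z $$ (i, j))) \<longlongrightarrow> - (H s $$ (i, j))) (at s)"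
      using c[OF ij] by (intro tendsto_minus) (simp add: isCont_def)
    \<comment> \<open>For z near s but different from it, \<open>transfer_fun_diff\<close> for the
      pair z, s is exactly the difference quotient.\<close>
    moreover have "\<forall>\<^sub>F z in at s. - (H z $$ (i, j)) = (?G z $$ (i, j) - ?G s $$ (i, j)) / (z - s)"
      using eventually_nhds_conv_at[THEN iffD1, OF ev, THEN conjunct1]
        eventually_neq_at_within[of s s UNIV]
    proof eventually_elim
      case (elim z)
      interpret z: two_point_pencil n m p E A B C z s
        using elim E A B C s.inv\<sigma> by unfold_locales
      show ?case using z.transfer_fun_diff[OF ij] elim by (simp add: H_def z.K_def)
    qed
    ultimately show "((\<lambda>z. ?G z $$ (i, j)) has_field_derivative - (s.K E $$ (i, j))) (at s)"
      unfolding has_field_derivative_iff Hs[symmetric] by (rule Lim_transform_eventually)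
  qed
  then show ?thesis
    using s.K_carrier[OF E] transfer_fun_carrier[OF B C, of E A s]
    by (intro eq_matI) (auto simp: mat_deriv_def)
qed

subsection \<open>Blocks of products\<close>

lemma block_index_less:
  fixes k p r N :: nat
  assumes "k \<in> {1..N}" "r < p"
  shows "(k - 1) * p + r < p * N"
proof -
  have "(k - 1) * p + r < (k - 1) * p + p" using assms by simp
  \<comment> \<open>Here k is at least 1, so the truncated subtraction is exact.\<close>
  also have "\<dots> = k * p" using assms by (cases k) auto
  also have "\<dots> \<le> p * N" using assms by simp
  finally show ?thesis .
qed

text \<open>For r < p the index \<open>(k - 1) * p + r\<close> has quotient k - 1 and remainder r
  modulo p; the shift by 1 in \<open>col_concat\<close> then returns to block k.\<close>

lemma row_block_col_concat:
  assumes "k \<in> {1..N}" "Y k \<in> carrier_mat p n"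
  shows "row_block p (col_concat p n N Y) k = Y k"
  using assms block_index_less[of k N _ p]
  by (intro eq_matI) (auto simp: row_block_def col_concat_def)

lemma col_block_row_concat:
  assumes "j \<in> {1..N}" "X j \<in> carrier_mat n m"
  shows "col_block m (row_concat n m N X) j = X j"
  using assms block_index_less[of j N _ m]
  by (intro eq_matI) (auto simp: col_block_def row_concat_def)

lemma row_block_mult:
  assumes "S \<in> carrier_mat (p * N) n" "M \<in> carrier_mat n l" "k \<in> {1..N}"
  shows "row_block p (S * M) k = row_block p S k * M"
  using assms block_index_less[of k N _ p]
  by (intro eq_matI) (auto simp: row_block_def scalar_prod_def)

lemma col_block_mult:
  assumes "M \<in> carrier_mat l n" "S \<in> carrier_mat n (m * N)" "j \<in> {1..N}"
  shows "col_block m (M * S) j = M * col_block m S j"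
  using assms block_index_less[of j N _ m]
  by (intro eq_matI) (auto simp: col_block_def scalar_prod_def)

lemma mat_block_mult:
  assumes "S \<in> carrier_mat (p * N) n" "T \<in> carrier_mat n (m * N)" "k \<in> {1..N}" "j \<in> {1..N}"
  shows "mat_block p m (S * T) k j = row_block p S k * col_block m T j"
  using assms block_index_less[of k N _ p] block_index_less[of j N _ m]
  by (intro eq_matI) (auto simp: mat_block_def row_block_def col_block_def scalar_prod_def)

section \<open>The blocks at symmetric nodes\<close>

theorem theorem1:
  fixes n m p N :: nat
    and E A B C R L EL AL BL CL :: "complex mat"
    and \<Phi> G G' :: "complex \<Rightarrow> complex mat"
    and \<zeta> \<rho> \<theta> \<phi> \<omega> \<xi> :: "nat \<Rightarrow> real"
  assumes E: "E \<in> carrier_mat n n"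
    and A: "A \<in> carrier_mat n n"
    and B: "B \<in> carrier_mat n m"
    and C: "C \<in> carrier_mat p n"
    and \<Phi>: "\<Phi> = pencil E A"
    and G: "G = transfer_fun E A B C"
    and G': "G' = mat_deriv G"
    and symmetric: "\<And>i. i \<in> {1..N} \<Longrightarrow> \<zeta> i = \<omega> i \<and> \<theta> i = - \<omega> i \<and> \<rho> i = \<xi> i \<and> \<phi> i = \<xi> i"
    and invertible: "\<And>i. i \<in> {1..N} \<Longrightarrow>
        invertible_mat (\<Phi> (\<i> * of_real (\<omega> i))) \<and> invertible_mat (\<Phi> (- \<i> * of_real (\<omega> i)))"
    and R_carrier: "R \<in> carrier_mat n (m * N)"
    and L_carrier: "L \<in> carrier_mat n (p * N)"
    and R: "R = row_concat n m N
        (\<lambda>i. of_real (\<rho> i) \<cdot>\<^sub>m (mat_inv (\<Phi> (\<i> * of_real (\<zeta> i))) * B))"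
    and L: "mat_adjoint L = col_concat p n N
        (\<lambda>i. of_real (\<phi> i) \<cdot>\<^sub>m (C * mat_inv (\<Phi> (\<i> * of_real (\<theta> i)))))"
    and EL: "EL = mat_adjoint L * E * R"
    and AL: "AL = mat_adjoint L * A * R"
    and BL: "BL = mat_adjoint L * B"
    and CL: "CL = C * R"
  shows "\<forall>k\<in>{1..N}. \<forall>j\<in>{1..N}.
      mat_block p m EL k j =
        (if \<omega> j = - \<omega> k
         then - of_real (\<xi> k * \<xi> j) \<cdot>\<^sub>m G' (\<i> * of_real (\<omega> j))
         else - of_real (\<xi> k * \<xi> j) \<cdot>\<^sub>m
           (inverse (- \<i> * of_real (\<omega> k) - \<i> * of_real (\<omega> j)) \<cdot>\<^sub>m
             (G (- \<i> * of_real (\<omega> k)) - G (\<i> * of_real (\<omega> j))))) \<and>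
      mat_block p m AL k j =
        (if \<omega> j = - \<omega> k
         then - of_real (\<xi> k * \<xi> j) \<cdot>\<^sub>m
           (G (\<i> * of_real (\<omega> j)) + (\<i> * of_real (\<omega> j)) \<cdot>\<^sub>m G' (\<i> * of_real (\<omega> j)))
         else - of_real (\<xi> k * \<xi> j) \<cdot>\<^sub>m
           (inverse (- \<i> * of_real (\<omega> k) - \<i> * of_real (\<omega> j)) \<cdot>\<^sub>m
             ((- \<i> * of_real (\<omega> k)) \<cdot>\<^sub>m G (- \<i> * of_real (\<omega> k)) -
              (\<i> * of_real (\<omega> j)) \<cdot>\<^sub>m G (\<i> * of_real (\<omega> j))))) \<and>
      row_block p BL k = of_real (\<xi> k) \<cdot>\<^sub>m G (- \<i> * of_real (\<omega> k)) \<and>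
      col_block m CL j = of_real (\<xi> j) \<cdot>\<^sub>m G (\<i> * of_real (\<omega> j))"
proof (intro ballI)
  fix k j assume k: "k \<in> {1..N}" and j: "j \<in> {1..N}"
  let ?\<sigma> = "- \<i> * of_real (\<omega> k)" and ?\<mu> = "\<i> * of_real (\<omega> j)"
  interpret kj: two_point_pencil n m p E A B C ?\<sigma> ?\<mu>
    using E A B C invertible[OF k] invertible[OF j] by unfold_locales (simp_all add: \<Phi>)
  let ?S = "mat_adjoint L"
  have S: "?S \<in> carrier_mat (p * N) n"
    using L by (simp add: col_concat_def)
  have CP: "C * kj.P \<in> carrier_mat p n" and QB: "kj.Q * B \<in> carrier_mat n m"
    using C B kj.P(1) kj.Q(1) by auto
  \<comment> \<open>Symmetry makes the left node the negative of \<open>\<omega> k\<close>, so the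
    inverse occurring here is \<open>kj.P\<close>.\<close>
  have Sk: "row_block p ?S k = of_real (\<xi> k) \<cdot>\<^sub>m (C * kj.P)"
    unfolding L using symmetric[OF k] CP by (subst row_block_col_concat[OF k]) (auto simp: \<Phi>)
  have Rj: "col_block m R j = of_real (\<xi> j) \<cdot>\<^sub>m (kj.Q * B)"
    unfolding R using symmetric[OF j] QB by (subst col_block_row_concat[OF j]) (auto simp: \<Phi>)
  have block: "mat_block p m (?S * M * R) k j = of_real (\<xi> k * \<xi> j) \<cdot>\<^sub>m kj.K M"
    if M: "M \<in> carrier_mat n n" for M
  proof -
    have CPM: "C * kj.P * M \<in> carrier_mat p n" using CP M by simp
    have "mat_block p m (?S * M * R) k j =
        (of_real (\<xi> k) \<cdot>\<^sub>m (C * kj.P)) * M * (of_real (\<xi> j) \<cdot>\<^sub>m (kj.Q * B))"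
      unfolding mat_block_mult[OF mult_carrier_mat[OF S M] R_carrier k j] row_block_mult[OF S M k]
        Sk Rj ..
    also have "\<dots> = of_real (\<xi> k * \<xi> j) \<cdot>\<^sub>m kj.K M"
      unfolding kj.K_def mult_smult_assoc_mat[OF CP M]
        mult_smult_assoc_mat[OF CPM smult_carrier_mat[OF QB]] mult_smult_distrib[OF CPM QB]
        smult_smult_mat of_real_mult ..
    finally show ?thesis .
  qed
  \<comment> \<open>The goal attaches the sign to the weights, the formulas for \<open>kj.K\<close>
    attach it to the matrix; this reconciles them.\<close>
  have neg: "- of_real (\<xi> k * \<xi> j) \<cdot>\<^sub>m X = of_real (\<xi> k * \<xi> j) \<cdot>\<^sub>m (- 1 \<cdot>\<^sub>m X)" for X :: "complex mat"
    by (simp add: smult_smult_mat one_smult_mat)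
  \<comment> \<open>Under this condition \<sigma> and \<mu> are the same point, so \<open>kj\<close>
    itself is the coincident instance.\<close>
  have deriv: "G' ?\<mu> = - 1 \<cdot>\<^sub>m kj.K E" if "\<omega> j = - \<omega> k"
    using mat_deriv_transfer_fun[of n m p E A B C ?\<mu>] kj.two_point_pencil_axioms that
    by (simp add: G G')
  have G_carrier: "G s \<in> carrier_mat p m" for s
    unfolding G by (rule transfer_fun_carrier[OF B C])
  have E1: "kj.K E = - 1 \<cdot>\<^sub>m G' ?\<mu>" if "\<omega> j = - \<omega> k"
    by (simp add: deriv[OF that] smult_smult_mat one_smult_mat)
  \<comment> \<open>No division is possible here, but one relation suffices: \<open>kj.K E\<close>
    is already known from the derivative, and \<open>K_A'\<close> then determines
    \<open>kj.K A\<close>.\<close>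
  have A1: "kj.K A = - 1 \<cdot>\<^sub>m (G ?\<mu> + ?\<mu> \<cdot>\<^sub>m G' ?\<mu>)" if eq: "\<omega> j = - \<omega> k"
    unfolding kj.K_A' deriv[OF eq]
    using kj.K_carrier[OF E] G_carrier[of ?\<mu>] eq by (intro eq_matI) (auto simp: G)
  have ne: "?\<sigma> \<noteq> ?\<mu>" if "\<omega> j \<noteq> - \<omega> k"
    using that by (auto simp: complex_eq_iff)
  have BL_k: "row_block p BL k = of_real (\<xi> k) \<cdot>\<^sub>m G ?\<sigma>"
    unfolding BL row_block_mult[OF S B k] Sk mult_smult_assoc_mat[OF CP B] G transfer_fun_def ..
  have CL_j: "col_block m CL j = of_real (\<xi> j) \<cdot>\<^sub>m G ?\<mu>"
    unfolding CL col_block_mult[OF C R_carrier j] Rj mult_smult_distrib[OF C QB] G transfer_fun_def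
    by (simp add: assoc_mult_mat[OF C kj.Q(1) B])
  show "mat_block p m EL k j =
        (if \<omega> j = - \<omega> k
         then - of_real (\<xi> k * \<xi> j) \<cdot>\<^sub>m G' (\<i> * of_real (\<omega> j))
         else - of_real (\<xi> k * \<xi> j) \<cdot>\<^sub>m
           (inverse (- \<i> * of_real (\<omega> k) - \<i> * of_real (\<omega> j)) \<cdot>\<^sub>m
             (G (- \<i> * of_real (\<omega> k)) - G (\<i> * of_real (\<omega> j))))) \<and>
      mat_block p m AL k j =
        (if \<omega> j = - \<omega> k
         then - of_real (\<xi> k * \<xi> j) \<cdot>\<^sub>m
           (G (\<i> * of_real (\<omega> j)) + (\<i> * of_real (\<omega> j)) \<cdot>\<^sub>m G' (\<i> * of_real (\<omega> j)))
         else - of_real (\<xi> k * \<xi> j) \<cdot>\<^sub>m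
           (inverse (- \<i> * of_real (\<omega> k) - \<i> * of_real (\<omega> j)) \<cdot>\<^sub>m
             ((- \<i> * of_real (\<omega> k)) \<cdot>\<^sub>m G (- \<i> * of_real (\<omega> k)) -
              (\<i> * of_real (\<omega> j)) \<cdot>\<^sub>m G (\<i> * of_real (\<omega> j))))) \<and>
      row_block p BL k = of_real (\<xi> k) \<cdot>\<^sub>m G (- \<i> * of_real (\<omega> k)) \<and>
      col_block m CL j = of_real (\<xi> j) \<cdot>\<^sub>m G (\<i> * of_real (\<omega> j))"
    unfolding EL AL block[OF E] block[OF A] neg
    using E1 A1 kj.K_E_distinct[OF ne] kj.K_A_distinct[OF ne] BL_k CL_j by (auto simp: G)
qed

end
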